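(* Let $q$ be a prime power, let $G(V,E)$ be a finite undirected graph with $V=\{1,\dots,n\}$, and let $S\subseteq V$ be a smallest $3$-path vertex cover of $G$. Then the dimension of any cooperative $2$-RDSS code over $\mathbb{F}_q$ for $G$ is at most $|S|$.
   Context: $G$ is simple. For $v\in V$, $N(v)$ is the set of neighbours of $v$; for $X\in\mathbb{F}_q^n$ and $I\subseteq V$, $X_I$ denotes the projection onto the coordinates in $I$. A $k$-path is a set of distinct vertices $v_1,\dots,v_k$ such that $(v_i,v_{i+1})\in E$ for $1\le i\le k-1$. A $k$-path vertex cover is a set $S$ of vertices such that every $k$-path of $G$ contains at least one vertex of $S$. A code $\mathcal{C}\subseteq\mathbb{F}_q^n$ is a cooperative $t$-RDSS code for $G$ if for every nonempty set $U\subseteq V$ with $|U|\le t$ that induces a connected subgraph there exist deterministic functions $f^U_i$, $i\in U$, such that for every codeword $X=(X_1,\dots,X_n)\in\mathcal{C}$ and every $i\in U$, $X_i=f^U_i\big(X_{(\bigcup_{l\in U}N(l))\setminus U}\big)$. The dimension of $\mathcal{C}$ is $\log_q|\mathcal{C}|$. *)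

theory Defs
  imports
    Complex_Main
    "HOL-Library.FuncSet"
    "HOL-Library.Cardinality"
    "HOL-Number_Theory.Prime_Powers"
    "Graph_Theory.Graph_Theory"
begin

text \<open>
  A finite simple undirected graph is a \<open>pair_graph\<close>: a finite loop-free digraph whose arcs form a
  symmetric relation, so that each edge \<open>{u, v}\<close> is represented by both \<open>(u, v)\<close> and \<open>(v, u)\<close>.
\<close>

definition neighbours :: "'v pair_pre_digraph \<Rightarrow> 'v \<Rightarrow> 'v set" where
  "neighbours G v = {w \<in> pverts G. (v, w) \<in> parcs G}"

definition k_path :: "'v pair_pre_digraph \<Rightarrow> nat \<Rightarrow> 'v list \<Rightarrow> bool" where
  "k_path G k p \<longleftrightarrow> vpath p (with_proj G) \<and> length p = k"

definition k_path_vertex_cover :: "'v pair_pre_digraph \<Rightarrow> nat \<Rightarrow> 'v set \<Rightarrow> bool" where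
  "k_path_vertex_cover G k S \<longleftrightarrow>
     S \<subseteq> pverts G \<and> (\<forall>p. k_path G k p \<longrightarrow> set p \<inter> S \<noteq> {})"

definition smallest_k_path_vertex_cover :: "'v pair_pre_digraph \<Rightarrow> nat \<Rightarrow> 'v set \<Rightarrow> bool" where
  "smallest_k_path_vertex_cover G k S \<longleftrightarrow>
     k_path_vertex_cover G k S \<and> (\<forall>T. k_path_vertex_cover G k T \<longrightarrow> card S \<le> card T)"

definition induces_connected :: "'v pair_pre_digraph \<Rightarrow> 'v set \<Rightarrow> bool" where
  "induces_connected G U \<longleftrightarrow> Digraph_Component.connected (with_proj G \<restriction> U)"

text \<open>
  Words over the alphabet \<open>'a\<close> indexed by the vertices are extensional functions on the vertex set
  (with value \<open>undefined\<close> elsewhere); \<open>restrict X I\<close> is then the projection of \<open>X\<close> to the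
  coordinates in \<open>I\<close>, and it carries no information about the other coordinates.
\<close>

definition cooperative_RDSS_code ::
    "nat \<Rightarrow> 'v pair_pre_digraph \<Rightarrow> ('v \<Rightarrow> 'a) set \<Rightarrow> bool" where
  "cooperative_RDSS_code t G C \<longleftrightarrow>
     C \<subseteq> (pverts G \<rightarrow>\<^sub>E UNIV) \<and>
     (\<forall>U. U \<subseteq> pverts G \<and> U \<noteq> {} \<and> card U \<le> t \<and> induces_connected G U \<longrightarrow>
        (\<exists>f :: 'v \<Rightarrow> ('v \<Rightarrow> 'a) \<Rightarrow> 'a. \<forall>X\<in>C. \<forall>i\<in>U.
           X i = f i (restrict X ((\<Union>l\<in>U. neighbours G l) - U))))"

text \<open>The empty code, which is not excluded, gets dimension \<open>0\<close> (\<open>log q 0 = 0\<close>).\<close>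

definition code_dim :: "nat \<Rightarrow> ('v \<Rightarrow> 'a) set \<Rightarrow> real" where
  "code_dim q C = log (real q) (real (card C))"

end

theory Submission
  imports Defs
begin

text \<open>
  If \<open>S\<close> meets every 3-path, then every component of \<open>G - S\<close> is a single vertex or a single edge,
  so it is repaired from coordinates in \<open>S\<close> alone. Hence a codeword is determined by its
  projection onto \<open>S\<close>.
\<close>

lemma induces_connected_singleton: "induces_connected G {v}"
  by (auto simp: induces_connected_def connected_def strongly_connected_def reachable_def)

text \<open>\<open>connected\<close> means strong connectedness of the symmetric closure, so the
  single arc \<open>(u, v)\<close> already gives both directions.\<close>

lemma induces_connected_edge:
  assumes "(u, v) \<in> parcs G"
  shows "induces_connected G {u, v}"
proof -
  let ?H = "with_proj (mk_symmetric (with_proj G \<restriction> {u, v}))"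
  have arcs: "(u, v) \<in> arcs_ends ?H" "(v, u) \<in> arcs_ends ?H"
    using assms by (auto simp: parcs_mk_symmetric)
  have "(x, y) \<in> rtrancl_on {u, v} (arcs_ends ?H)" if "x \<in> {u, v}" "y \<in> {u, v}" for x y
    using that arcs rtrancl_on_into_rtrancl_on[of x x "{u, v}" _ y] by auto
  then show ?thesis
    by (auto simp: induces_connected_def connected_def strongly_connected_def reachable_def)
qed

lemma k_path_3I:
  assumes "a \<in> pverts G" "b \<in> pverts G" "c \<in> pverts G"
    and "(a, b) \<in> parcs G" "(b, c) \<in> parcs G" and "distinct [a, b, c]"
  shows "k_path G 3 [a, b, c]"
  using assms by (simp add: k_path_def vpath_def vwalk_def)

text \<open>Take \<open>U\<close> to be the component of \<open>v\<close> in \<open>G - S\<close>: a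
  third vertex outside \<open>S\<close> adjacent to an edge outside \<open>S\<close> would complete
  a 3-path that avoids \<open>S\<close>.\<close>

lemma repair_group_outside_3_path_cover:
  assumes "pair_graph G" and cover: "k_path_vertex_cover G 3 S"
    and v: "v \<in> pverts G" "v \<notin> S"
  obtains U where "v \<in> U" "U \<subseteq> pverts G" "card U \<le> 2" "induces_connected G U"
    "(\<Union>l\<in>U. neighbours G l) - U \<subseteq> S"
proof -
  interpret pair_graph G by fact
  have sym: "(b, a) \<in> parcs G" if "(a, b) \<in> parcs G" for a b
    using that by (rule arcs_symmetric)
  have no_path: "a \<in> S \<or> b \<in> S \<or> c \<in> S"
    if "k_path G 3 [a, b, c]" for a b c
    using cover that by (fastforce simp: k_path_vertex_cover_def)
  show thesis
  proof (cases "neighbours G v \<subseteq> S")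
    case True
    then show ?thesis
      using v by (intro that[of "{v}"]) (auto intro: induces_connected_singleton)
  next
    case False
    then obtain w where w: "w \<in> pverts G" "(v, w) \<in> parcs G" "w \<notin> S"
      by (auto simp: neighbours_def)
    have "v \<noteq> w"
      using w no_loops[of "(v, w)"] by auto
    have "x \<in> S" if x: "x \<in> pverts G" "x \<noteq> v" "x \<noteq> w" "(v, x) \<in> parcs G \<or> (w, x) \<in> parcs G" for x
      using x(4)
    proof
      assume "(v, x) \<in> parcs G"
      \<comment> \<open>Here \<open>v\<close> is the middle vertex, so the arc \<open>(v, w)\<close>
        has to be reversed; in the other case the middle vertex is \<open>w\<close>.\<close>
      then have "k_path G 3 [w, v, x]"
        using v w x \<open>v \<noteq> w\<close> by (intro k_path_3I) (auto intro: sym)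
      then show ?thesis using no_path v w by blast
    next
      assume "(w, x) \<in> parcs G"
      then have "k_path G 3 [v, w, x]"
        using v w x \<open>v \<noteq> w\<close> by (intro k_path_3I) auto
      then show ?thesis using no_path v w by blast
    qed
    then have "(\<Union>l\<in>{v, w}. neighbours G l) - {v, w} \<subseteq> S"
      by (auto simp: neighbours_def)
    then show ?thesis
      using v w \<open>v \<noteq> w\<close> by (intro that[of "{v, w}"]) (auto intro: induces_connected_edge)
  qed
qed

text \<open>Codewords that agree on \<open>S\<close> feed equal inputs to the repair functions of
  every vertex outside \<open>S\<close>. Injectivity is the form needed to count codewords.\<close>

lemma inj_on_restrict_3_path_cover:
  assumes G: "pair_graph G" and cover: "k_path_vertex_cover G 3 S"
    and code: "cooperative_RDSS_code 2 G C"
  shows "inj_on (\<lambda>X. restrict X S) C"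
proof (rule inj_onI)
  fix X Y assume XY: "X \<in> C" "Y \<in> C" and eq: "restrict X S = restrict Y S"
  have eqS: "X s = Y s" if "s \<in> S" for s
    using fun_cong[OF eq, of s] that by simp
  show "X = Y"
  \<comment> \<open>Codewords are \<open>undefined\<close> off \<open>pverts G\<close>, so agreement
    on the vertices gives equality.\<close>
  proof (rule PiE_ext)
    show "X \<in> pverts G \<rightarrow>\<^sub>E UNIV" "Y \<in> pverts G \<rightarrow>\<^sub>E UNIV"
      using code XY unfolding cooperative_RDSS_code_def by blast+
    fix v assume v: "v \<in> pverts G"
    show "X v = Y v"
    proof (cases "v \<in> S")
      case False
      obtain U where U: "v \<in> U" "U \<subseteq> pverts G" "card U \<le> 2" "induces_connected G U"
        and sub: "(\<Union>l\<in>U. neighbours G l) - U \<subseteq> S"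
        using repair_group_outside_3_path_cover[OF G cover v False] by metis
      let ?I = "(\<Union>l\<in>U. neighbours G l) - U"
      have "U \<noteq> {}" using U(1) by blast
      \<comment> \<open>The choice of \<open>f\<close> depends on \<open>U\<close> only, so the same
        \<open>f\<close> repairs both \<open>X\<close> and \<open>Y\<close>.\<close>
      with code U obtain f where f: "\<forall>Z\<in>C. \<forall>i\<in>U. Z i = f i (restrict Z ?I)"
        unfolding cooperative_RDSS_code_def by meson
      have "restrict X ?I = restrict Y ?I"
        using sub by (intro restrict_ext eqS) blast
      then show ?thesis using f XY U(1) by metis
    qed (rule eqS)
  qed
qed

theorem proposition13:
  fixes q n :: nat
    and G :: "nat pair_pre_digraph"
    and S :: "nat set"
    and C :: "(nat \<Rightarrow> 'a::{field, finite}) set"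
  assumes "primepow q" and "CARD('a) = q"
    and "pair_graph G" and "pverts G = {1..n}"
    and "smallest_k_path_vertex_cover G 3 S"
    and "cooperative_RDSS_code 2 G C"
  shows "code_dim q C \<le> real (card S)"
proof -
  have cover: "k_path_vertex_cover G 3 S"
    using assms(5) by (simp add: smallest_k_path_vertex_cover_def)
  then have fin: "finite S"
    using assms(4) finite_subset by (auto simp: k_path_vertex_cover_def)
  \<comment> \<open>Projection embeds \<open>C\<close> into the words indexed by \<open>S\<close>,
    of which there are \<open>q ^ card S\<close>.\<close>
  have "card C \<le> card (S \<rightarrow>\<^sub>E (UNIV :: 'a set))"
    using inj_on_restrict_3_path_cover[OF assms(3) cover assms(6)] fin
    by (intro card_inj_on_le[where f = "\<lambda>X. restrict X S"]) (auto intro: finite_PiE)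
  also have "\<dots> = q ^ card S"
    using fin assms(2) by (simp add: card_PiE)
  finally have le: "real (card C) \<le> real q ^ card S"
    by (metis of_nat_le_iff of_nat_power)
  have q: "real q > 1"
    using primepow_gt_Suc_0[OF assms(1)] by simp
  show ?thesis
  \<comment> \<open>Monotonicity of \<open>log\<close> needs a positive argument. For
    \<open>card C = 0\<close> the convention \<open>ln 0 = 0\<close> makes the dimension 0.\<close>
  proof (cases "card C = 0")
    case True
    then show ?thesis by (simp add: code_dim_def log_def)
  next
    case False
    then have "log (real q) (real (card C)) \<le> log (real q) (real q ^ card S)"
      using le q by (intro log_mono) auto
    also have "\<dots> = real (card S)"
      using q by (simp add: log_nat_power)
    finally show ?thesis by (simp add: code_dim_def)
  qed
qed

end
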